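(* For all process terms $e,f\in\mathsf{Term}$, if $e\approx f$ then $e\equiv f$.
   Context: $A$ is a fixed finite set of actions. Terms over countably many variables: $e::= v\mid ae\mid e_1+e_2\mid\mu v\,e$ ($a\in A$). A process term is a closed term (every occurrence of $v$ lies in the scope of $\mu v$) that is guarded (each such occurrence lies, inside its binder, within some prefix $a(-)$); $\mathsf{Term}$ is the set of process terms. $e[g/v]$ denotes capture-avoiding substitution. LTS structure on $\mathsf{Term}$: least relation with $ae\xrightarrow{a}e$; $e_i\xrightarrow{a}f\Rightarrow e_1+e_2\xrightarrow{a}f$ ($i=1,2$); $e[\mu v\,e/v]\xrightarrow{a}f\Rightarrow\mu v\,e\xrightarrow{a}f$. $\operatorname{str}(e)$: streams $(a_1,\dots)\in A^\omega$ with, for every $n$, a path $e\xrightarrow{a_1}\cdots\xrightarrow{a_n}e_n$. Provable equivalence $\equiv$: smallest equivalence relation on terms closed under equational logic and: (ID) $e+e\equiv e$; (CM) $e_2+e_1\equiv e_1+e_2$; (AS) $e_1+(e_2+e_3)\equiv(e_1+e_2)+e_3$; (DS) $a(e_1+e_2)\equiv ae_1+ae_2$; (FP) $\mu v\,e\equiv e[\mu v\,e/v]$; (CN) if $e_i\equiv f_i$ for all $i$ then $g[\vec e/\vec v]\equiv g[\vec f/\vec v]$, where $g$ has exactly the free variables $v_1,\dots,v_n$ and no variable free in any $f_i$ is bound in $g$; (AE) $\mu w\,e\equiv\mu v\,e[v/w]$ where $v$ is not free in $e$; (UA) if $g\equiv e[g/v]$ then $g\equiv\mu v\,e$. Fractal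 equivalence: for a complete metric space $(M,d)$ and $\sigma:A\to\operatorname{Con}(M,d)$ (contractions), $\sigma_\omega(a_1,\dots)=\lim_n\sigma_{a_1}\cdots\sigma_{a_n}(p)$ ($p\in M$ arbitrary), $[\![e]\!]_\sigma=\{\sigma_\omega(s):s\in\operatorname{str}(e)\}$; $e\approx f$ iff $[\![e]\!]_\sigma=[\![f]\!]_\sigma$ for all such $(M,d)$ and $\sigma$. *)

theory Defs
  imports "HOL-Analysis.Analysis"
begin

section \<open>Terms\<close>

datatype 'a trm =
    Var nat
  | Pre 'a "'a trm"
  | Sum "'a trm" "'a trm"
  | Mu nat "'a trm"

primrec fv :: "'a trm \<Rightarrow> nat set" where
  "fv (Var v) = {v}"
| "fv (Pre a e) = fv e"
| "fv (Sum e1 e2) = fv e1 \<union> fv e2"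
| "fv (Mu v e) = fv e - {v}"

primrec bv :: "'a trm \<Rightarrow> nat set" where
  "bv (Var v) = {}"
| "bv (Pre a e) = bv e"
| "bv (Sum e1 e2) = bv e1 \<union> bv e2"
| "bv (Mu v e) = insert v (bv e)"

text \<open>The variables with a free occurrence that is not within any prefix.\<close>

primrec unguarded_fv :: "'a trm \<Rightarrow> nat set" where
  "unguarded_fv (Var v) = {v}"
| "unguarded_fv (Pre a e) = {}"
| "unguarded_fv (Sum e1 e2) = unguarded_fv e1 \<union> unguarded_fv e2"
| "unguarded_fv (Mu v e) = unguarded_fv e - {v}"

text \<open>Only bound occurrences have to be guarded, so guardedness also applies to open terms.\<close>

primrec guarded :: "'a trm \<Rightarrow> bool" where
  "guarded (Var v) \<longleftrightarrow> True"
| "guarded (Pre a e) \<longleftrightarrow> guarded e"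
| "guarded (Sum e1 e2) \<longleftrightarrow> guarded e1 \<and> guarded e2"
| "guarded (Mu v e) \<longleftrightarrow> guarded e \<and> v \<notin> unguarded_fv e"

definition process_terms :: "'a trm set" where
  "process_terms = {e. fv e = {} \<and> guarded e}"

text \<open>Terms are not identified up to renaming of bound variables (that is the axiom AE below), so
  capture is avoided by an explicit choice: a binder is renamed only if it would capture a variable,
  and then to the least variable that is safe.\<close>

primrec psubst :: "(nat \<Rightarrow> 'a trm) \<Rightarrow> 'a trm \<Rightarrow> 'a trm" where
  "psubst s (Var v) = s v"
| "psubst s (Pre a e) = Pre a (psubst s e)"
| "psubst s (Sum e1 e2) = Sum (psubst s e1) (psubst s e2)"
| "psubst s (Mu v e) =
    (let X = (\<Union>x \<in> fv e - {v}. fv (s x));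
         w = (if v \<in> X then (LEAST w. w \<notin> X) else v)
     in Mu w (psubst (s(v := Var w)) e))"

definition subst :: "'a trm \<Rightarrow> 'a trm \<Rightarrow> nat \<Rightarrow> 'a trm"  (\<open>_[_'/_]\<close> [1000, 0, 0] 1000) where
  "e[g/v] = psubst (Var(v := g)) e"


section \<open>Operational semantics\<close>

text \<open>Stated for all terms; transitions from a process term involve process terms only.\<close>

inductive step :: "'a trm \<Rightarrow> 'a \<Rightarrow> 'a trm \<Rightarrow> bool" where
  step_Pre: "step (Pre a e) a e"
| step_Sum1: "step e1 a f \<Longrightarrow> step (Sum e1 e2) a f"
| step_Sum2: "step e2 a f \<Longrightarrow> step (Sum e1 e2) a f"
| step_Mu: "step (e[Mu v e/v]) a f \<Longrightarrow> step (Mu v e) a f"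

primrec steps :: "'a trm \<Rightarrow> 'a list \<Rightarrow> 'a trm \<Rightarrow> bool" where
  "steps e [] f \<longleftrightarrow> e = f"
| "steps e (a # w) f \<longleftrightarrow> (\<exists>g. step e a g \<and> steps g w f)"

definition str :: "'a trm \<Rightarrow> (nat \<Rightarrow> 'a) set" where
  "str e = {s. \<forall>n. \<exists>f. steps e (map s [0..<n]) f}"


section \<open>Provable equivalence\<close>

text \<open>The relation lives on guarded, possibly open, terms. Without guardedness, UA with
  \<open>e = Var v\<close> would give \<open>g \<equiv> Mu v (Var v)\<close> for every \<open>g\<close>. Congruence for prefixing and
  sums is an instance of CN, in which only the values of \<open>s\<close> and \<open>t\<close> on \<open>fv g\<close> matter.\<close>

inductive prov_equiv :: "'a trm \<Rightarrow> 'a trm \<Rightarrow> bool"  (infix \<open>\<equiv>\<^sub>p\<close> 50) where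
  refl: "guarded e \<Longrightarrow> e \<equiv>\<^sub>p e"
| sym: "e \<equiv>\<^sub>p f \<Longrightarrow> f \<equiv>\<^sub>p e"
| trans: "e \<equiv>\<^sub>p f \<Longrightarrow> f \<equiv>\<^sub>p g \<Longrightarrow> e \<equiv>\<^sub>p g"
| ID: "guarded e \<Longrightarrow> Sum e e \<equiv>\<^sub>p e"
| CM: "guarded e1 \<Longrightarrow> guarded e2 \<Longrightarrow> Sum e2 e1 \<equiv>\<^sub>p Sum e1 e2"
| AS: "guarded e1 \<Longrightarrow> guarded e2 \<Longrightarrow> guarded e3 \<Longrightarrow>
        Sum e1 (Sum e2 e3) \<equiv>\<^sub>p Sum (Sum e1 e2) e3"
| DS: "guarded e1 \<Longrightarrow> guarded e2 \<Longrightarrow>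
        Pre a (Sum e1 e2) \<equiv>\<^sub>p Sum (Pre a e1) (Pre a e2)"
| FP: "guarded (Mu v e) \<Longrightarrow> Mu v e \<equiv>\<^sub>p e[Mu v e/v]"
| CN: "guarded g \<Longrightarrow> (\<And>v. v \<in> fv g \<Longrightarrow> s v \<equiv>\<^sub>p t v) \<Longrightarrow>
        (\<And>v. v \<in> fv g \<Longrightarrow> fv (t v) \<inter> bv g = {}) \<Longrightarrow> psubst s g \<equiv>\<^sub>p psubst t g"
| AE: "guarded (Mu w e) \<Longrightarrow> v \<notin> fv e \<Longrightarrow> Mu w e \<equiv>\<^sub>p Mu v (e[Var v/w])"
| UA: "guarded (Mu v e) \<Longrightarrow> g \<equiv>\<^sub>p e[g/v] \<Longrightarrow> g \<equiv>\<^sub>p Mu v e"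


section \<open>Fractal equivalence\<close>

definition contraction :: "'m set \<Rightarrow> ('m \<Rightarrow> 'm \<Rightarrow> real) \<Rightarrow> ('m \<Rightarrow> 'm) \<Rightarrow> bool" where
  "contraction M d h \<longleftrightarrow> h \<in> M \<rightarrow> M \<and>
     (\<exists>c. 0 \<le> c \<and> c < 1 \<and> (\<forall>x\<in>M. \<forall>y\<in>M. d (h x) (h y) \<le> c * d x y))"

definition contraction_system ::
    "'m set \<Rightarrow> ('m \<Rightarrow> 'm \<Rightarrow> real) \<Rightarrow> ('a \<Rightarrow> 'm \<Rightarrow> 'm) \<Rightarrow> bool" where
  "contraction_system M d \<sigma> \<longleftrightarrow>
     M \<noteq> {} \<and> Metric_space M d \<and> Metric_space.mcomplete M d \<and> (\<forall>a. contraction M d (\<sigma> a))"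

definition sigma_omega ::
    "'m set \<Rightarrow> ('m \<Rightarrow> 'm \<Rightarrow> real) \<Rightarrow> ('a \<Rightarrow> 'm \<Rightarrow> 'm) \<Rightarrow> (nat \<Rightarrow> 'a) \<Rightarrow> 'm" where
  "sigma_omega M d \<sigma> s =
     (THE l. \<forall>p\<in>M. limitin (Metric_space.mtopology M d)
                            (\<lambda>n. foldr \<sigma> (map s [0..<n]) p) l sequentially)"

definition fractal ::
    "'m set \<Rightarrow> ('m \<Rightarrow> 'm \<Rightarrow> real) \<Rightarrow> ('a \<Rightarrow> 'm \<Rightarrow> 'm) \<Rightarrow> 'a trm \<Rightarrow> 'm set" where
  "fractal M d \<sigma> e = sigma_omega M d \<sigma> ` str e"

text \<open>HOL cannot quantify over the type of points, so the points are taken to be (arbitrary sets of)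
  real numbers, under an arbitrary metric. Lemma \<open>fractal_equiv_all\<close> below shows that this
  covers the complete metric spaces over every type.\<close>

definition fractal_equiv :: "'a trm \<Rightarrow> 'a trm \<Rightarrow> bool"  (infix \<open>\<approx>\<^sub>f\<close> 50) where
  "e \<approx>\<^sub>f f \<longleftrightarrow>
     (\<forall>(M :: real set) d \<sigma>. contraction_system M d \<sigma> \<longrightarrow> fractal M d \<sigma> e = fractal M d \<sigma> f)"

lemma foldr_in_space:
  assumes "\<And>a. \<sigma> a \<in> M \<rightarrow> M" "p \<in> M"
  shows "foldr \<sigma> w p \<in> M"
  using assms by (induction w) (auto simp: Pi_iff)

lemma contraction_system_uniform:
  fixes \<sigma> :: "'a::finite \<Rightarrow> 'm \<Rightarrow> 'm"
  assumes "contraction_system M d \<sigma>"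
  obtains c where "0 \<le> c" "c < 1"
    "\<And>a x y. x \<in> M \<Longrightarrow> y \<in> M \<Longrightarrow> d (\<sigma> a x) (\<sigma> a y) \<le> c * d x y"
proof -
  interpret Metric_space M d using assms by (simp add: contraction_system_def)
  have "\<forall>a. \<exists>c. 0 \<le> c \<and> c < 1 \<and> (\<forall>x\<in>M. \<forall>y\<in>M. d (\<sigma> a x) (\<sigma> a y) \<le> c * d x y)"
    using assms by (auto simp: contraction_system_def contraction_def)
  then obtain k where k: "\<And>a. 0 \<le> k a" "\<And>a. k a < 1"
    "\<And>a x y. x \<in> M \<Longrightarrow> y \<in> M \<Longrightarrow> d (\<sigma> a x) (\<sigma> a y) \<le> k a * d x y"
    by metis
  let ?c = "Max (range k)"
  have le: "k a \<le> ?c" for a by simp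
  show thesis
  proof
    show "0 \<le> ?c" using le k(1) order_trans by blast
    show "?c < 1" using k(2) by simp
    show "d (\<sigma> a x) (\<sigma> a y) \<le> ?c * d x y" if "x \<in> M" "y \<in> M" for a x y
      using k(3)[OF that] mult_right_mono[OF le nonneg, of a x y] order_trans by blast
  qed
qed

lemma sigma_omega_exists:
  fixes \<sigma> :: "'a::finite \<Rightarrow> 'm \<Rightarrow> 'm"
  assumes sys: "contraction_system M d \<sigma>"
  shows "\<exists>l. \<forall>p\<in>M. limitin (Metric_space.mtopology M d)
                      (\<lambda>n. foldr \<sigma> (map s [0..<n]) p) l sequentially"
proof -
  interpret Metric_space M d using sys by (simp add: contraction_system_def)
  have comp: mcomplete and maps: "\<And>a. \<sigma> a \<in> M \<rightarrow> M"
    using sys by (auto simp: contraction_system_def contraction_def)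
  obtain p where p: "p \<in> M" using sys by (auto simp: contraction_system_def)
  obtain c where c: "0 \<le> c" "c < 1"
    and con: "\<And>a x y. x \<in> M \<Longrightarrow> y \<in> M \<Longrightarrow> d (\<sigma> a x) (\<sigma> a y) \<le> c * d x y"
    using contraction_system_uniform[OF sys] by blast
  note inM = foldr_in_space[of \<sigma>, OF maps]
  have pow: "d (foldr \<sigma> w x) (foldr \<sigma> w y) \<le> c ^ length w * d x y"
    if "x \<in> M" "y \<in> M" for w x y
  proof (induction w)
    case (Cons a w)
    have "d (foldr \<sigma> (a # w) x) (foldr \<sigma> (a # w) y) \<le> c * d (foldr \<sigma> w x) (foldr \<sigma> w y)"
      using con inM that by simp
    also have "\<dots> \<le> c * (c ^ length w * d x y)"
      using Cons c(1) by (rule mult_left_mono)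
    finally show ?case by (simp add: mult.assoc)
  qed simp
  define K where "K = Max (range (\<lambda>a. d (\<sigma> a p) p))"
  have K: "d (\<sigma> a p) p \<le> K" for a by (simp add: K_def)
  define R where "R = K / (1 - c)"
  have R: "c * R + K = R" using c(2) by (simp add: R_def field_simps)
  have "0 \<le> K" using order_trans[OF nonneg K] .
  then have R0: "0 \<le> R" using c(2) by (simp add: R_def)
  have bound: "d (foldr \<sigma> w p) p \<le> R" for w
  proof (induction w)
    case Nil then show ?case using R0 p by simp
  next
    case (Cons a w)
    have "d (foldr \<sigma> (a # w) p) p \<le> d (\<sigma> a (foldr \<sigma> w p)) (\<sigma> a p) + d (\<sigma> a p) p"
      using triangle inM[OF p] maps p by (simp add: Pi_iff)
    also have "\<dots> \<le> c * d (foldr \<sigma> w p) p + K"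
      using con[OF inM[OF p] p] K add_mono by blast
    also have "\<dots> \<le> c * R + K" using Cons c(1) by (simp add: mult_left_mono)
    finally show ?case using R by simp
  qed
  let ?x = "\<lambda>q n. foldr \<sigma> (map s [0..<n]) q"
  have tail: "d (?x p n) (?x p m) \<le> c ^ n * R" if "n \<le> m" for n m
  proof -
    have "map s [0..<m] = map s [0..<n] @ map s [n..<m]"
      using that by (metis le_add_diff_inverse map_append upt_add_eq_append zero_le)
    then have "d (?x p n) (?x p m) \<le> c ^ n * d p (foldr \<sigma> (map s [n..<m]) p)"
      using pow[OF p inM[OF p], of "map s [0..<n]" "map s [n..<m]"] by simp
    also have "\<dots> \<le> c ^ n * R"
      using bound c(1) by (simp add: commute mult_left_mono)
    finally show ?thesis .
  qed
  have lim0: "(\<lambda>n. c ^ n * b) \<longlonglongrightarrow> 0" for b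
    using tendsto_mult_left_zero[OF LIMSEQ_realpow_zero[OF c]] by blast
  have "MCauchy (?x p)"
    unfolding MCauchy_def
  proof (intro conjI allI impI)
    show "range (?x p) \<subseteq> M" using inM p by blast
    fix \<epsilon> :: real assume "\<epsilon> > 0"
    then have "\<forall>\<^sub>F n in sequentially. c ^ n * R < \<epsilon>"
      using order_tendstoD(2)[OF lim0] by blast
    then obtain N where N: "\<And>n. n \<ge> N \<Longrightarrow> c ^ n * R < \<epsilon>"
      by (auto simp: eventually_sequentially)
    have "d (?x p n) (?x p m) < \<epsilon>" if "N \<le> n" "N \<le> m" for n m
    proof (cases "n \<le> m")
      case True then show ?thesis using tail N[OF that(1)] by fastforce
    next
      case False
      then have "d (?x p m) (?x p n) \<le> c ^ m * R" using tail by simp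
      then show ?thesis using le_less_trans[OF _ N[OF that(2)]] by (simp add: commute)
    qed
    then show "\<exists>N. \<forall>n n'. N \<le> n \<longrightarrow> N \<le> n' \<longrightarrow> d (?x p n) (?x p n') < \<epsilon>" by blast
  qed
  then obtain l where l: "limitin mtopology (?x p) l sequentially"
    using comp by (auto simp: mcomplete_def)
  have "limitin mtopology (?x q) l sequentially" if q: "q \<in> M" for q
    unfolding limitin_metric_dist_null
  proof (intro conjI)
    show lM: "l \<in> M" using l by (rule limitin_mspace)
    show "\<forall>\<^sub>F n in sequentially. ?x q n \<in> M" using inM q by simp
    have 1: "(\<lambda>n. c ^ n * d q p + d (?x p n) l) \<longlonglongrightarrow> 0"
      using tendsto_add[OF lim0[of "d q p"], of "\<lambda>n. d (?x p n) l" 0] l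
      by (simp add: limitin_metric_dist_null)
    have 2: "d (?x q n) l \<le> c ^ n * d q p + d (?x p n) l" for n
      using triangle[OF inM[OF q] inM[OF p] lM, of "map s [0..<n]" "map s [0..<n]"]
        pow[OF q p, of "map s [0..<n]"] by simp
    show "(\<lambda>n. d (?x q n) l) \<longlonglongrightarrow> 0"
      by (rule tendsto_sandwich[OF _ _ tendsto_const 1]) (simp_all add: 2)
  qed
  then show ?thesis by blast
qed

lemma sigma_omega_eqI:
  fixes \<sigma> :: "'a::finite \<Rightarrow> 'm \<Rightarrow> 'm"
  assumes sys: "contraction_system M d \<sigma>" and p: "p \<in> M"
    and l: "limitin (Metric_space.mtopology M d)
              (\<lambda>n. foldr \<sigma> (map s [0..<n]) p) l sequentially"
  shows "sigma_omega M d \<sigma> s = l"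
proof -
  interpret Metric_space M d using sys by (simp add: contraction_system_def)
  obtain l' where l': "\<And>p. p \<in> M \<Longrightarrow>
      limitin mtopology (\<lambda>n. foldr \<sigma> (map s [0..<n]) p) l' sequentially"
    using sigma_omega_exists[OF sys] by blast
  have "l' = l" using limitin_metric_unique[OF l'[OF p] l] by simp
  show ?thesis unfolding sigma_omega_def
  proof (rule the_equality)
    show "\<forall>p\<in>M. limitin mtopology (\<lambda>n. foldr \<sigma> (map s [0..<n]) p) l sequentially"
      using l' \<open>l' = l\<close> by blast
    fix k assume "\<forall>p\<in>M. limitin mtopology (\<lambda>n. foldr \<sigma> (map s [0..<n]) p) k sequentially"
    then have k: "limitin mtopology (\<lambda>n. foldr \<sigma> (map s [0..<n]) p) k sequentially"
      using p by blast
    show "k = l" using limitin_metric_unique[OF k l] by simp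
  qed
qed

lemma sigma_omega_limitin:
  fixes \<sigma> :: "'a::finite \<Rightarrow> 'm \<Rightarrow> 'm"
  assumes sys: "contraction_system M d \<sigma>" and p: "p \<in> M"
  shows "limitin (Metric_space.mtopology M d)
           (\<lambda>n. foldr \<sigma> (map s [0..<n]) p) (sigma_omega M d \<sigma> s) sequentially"
proof -
  obtain l where l: "limitin (Metric_space.mtopology M d)
      (\<lambda>n. foldr \<sigma> (map s [0..<n]) p) l sequentially"
    using sigma_omega_exists[OF sys, of s] p by blast
  then show ?thesis using sigma_omega_eqI[OF sys p l] by simp
qed

lemma fractal_equiv_all:
  fixes e f :: "'a::finite trm" and M :: "'m set"
  assumes equiv: "e \<approx>\<^sub>f f" and sys: "contraction_system M d \<sigma>"
  shows "fractal M d \<sigma> e = fractal M d \<sigma> f"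
proof -
  interpret Metric_space M d using sys by (simp add: contraction_system_def)
  have comp: mcomplete and maps: "\<And>a. \<sigma> a \<in> M \<rightarrow> M"
    using sys by (auto simp: contraction_system_def contraction_def)
  obtain p where p: "p \<in> M" using sys by (auto simp: contraction_system_def)
  obtain c where c: "0 \<le> c" "c < 1"
    and con: "\<And>a x y. x \<in> M \<Longrightarrow> y \<in> M \<Longrightarrow> d (\<sigma> a x) (\<sigma> a y) \<le> c * d x y"
    using contraction_system_uniform[OF sys] by blast
  note inM = foldr_in_space[of \<sigma>, OF maps]
  define W where "W = range (\<lambda>w. foldr \<sigma> w p)"
  define C where "C = mtopology closure_of W"
  have WM: "W \<subseteq> M" using inM p by (auto simp: W_def)
  have C_seq: "C = {x \<in> M. \<exists>y. range y \<subseteq> W \<and> limitin mtopology y x sequentially}"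
    using WM by (auto simp: C_def closure_of_sequentially)
  have CM: "C \<subseteq> M" by (auto simp: C_seq)
  have pW: "p \<in> W" unfolding W_def by (rule range_eqI[of _ _ "[]"]) simp
  have pC: "p \<in> C"
    using pW WM by (auto simp: C_def intro!: subsetD[OF closure_of_subset])
  have Cmaps: "\<sigma> a x \<in> C" if x: "x \<in> C" for a x
  proof -
    obtain y where y: "range y \<subseteq> W" "limitin mtopology y x sequentially"
      using x by (auto simp: C_seq)
    have xM: "x \<in> M" using x CM by blast
    have yM: "y n \<in> M" for n using y(1) WM by blast
    have "limitin mtopology (\<lambda>n. \<sigma> a (y n)) (\<sigma> a x) sequentially"
      unfolding limitin_metric_dist_null
    proof (intro conjI)
      show "\<sigma> a x \<in> M" "\<forall>\<^sub>F n in sequentially. \<sigma> a (y n) \<in> M"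
        using maps xM yM by (auto simp: Pi_iff)
      have 1: "(\<lambda>n. c * d (y n) x) \<longlonglongrightarrow> 0"
        using y(2) tendsto_mult_right_zero unfolding limitin_metric_dist_null by blast
      show "(\<lambda>n. d (\<sigma> a (y n)) (\<sigma> a x)) \<longlonglongrightarrow> 0"
        by (rule tendsto_sandwich[OF _ _ tendsto_const 1]) (simp_all add: con[OF yM xM])
    qed
    moreover have "range (\<lambda>n. \<sigma> a (y n)) \<subseteq> W"
    proof clarify
      fix n
      obtain w where "y n = foldr \<sigma> w p" using y(1) by (auto simp: W_def)
      then have "\<sigma> a (y n) = foldr \<sigma> (a # w) p" by simp
      then show "\<sigma> a (y n) \<in> W" unfolding W_def by blast
    qed
    ultimately show ?thesis using maps xM by (auto simp: C_seq Pi_iff)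
  qed

  have "C \<lesssim> (UNIV :: real set)"
  proof -
    have cW: "countable W" unfolding W_def by (rule countable_image) simp
    have "\<forall>x\<in>C. \<exists>y. range y \<subseteq> W \<and> limitin mtopology y x sequentially"
      by (auto simp: C_seq)
    then obtain y where y: "\<And>x. x \<in> C \<Longrightarrow> range (y x) \<subseteq> W"
      "\<And>x. x \<in> C \<Longrightarrow> limitin mtopology (y x) x sequentially"
      by metis
    define code where "code x = range (\<lambda>n. prod_encode (n, to_nat_on W (y x n)))" for x
    have "inj_on code C"
    proof (rule inj_onI)
      fix x x' assume x: "x \<in> C" and x': "x' \<in> C" and eq: "code x = code x'"
      have "y x n = y x' n" for n
      proof -
        have "prod_encode (n, to_nat_on W (y x n)) \<in> code x'"
          unfolding eq[symmetric] by (simp add: code_def)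
        then have "to_nat_on W (y x n) = to_nat_on W (y x' n)"
          by (auto simp: code_def)
        then show ?thesis
          using inj_onD[OF inj_on_to_nat_on[OF cW]] y(1)[OF x] y(1)[OF x'] by fast
      qed
      then have "y x = y x'" by blast
      then show "x = x'"
        using limitin_metric_unique[OF y(2)[OF x]] y(2)[OF x'] by simp
    qed
    then have "C \<lesssim> (UNIV :: nat set set)" by (auto simp: lepoll_def)
    then show ?thesis using nat_sets_eqpoll_reals lepoll_trans2 by blast
  qed
  then obtain h :: "'m \<Rightarrow> real" where h: "inj_on h C" by (auto simp: lepoll_def)
  define g where "g = inv_into C h"
  have gh: "g (h x) = x" if "x \<in> C" for x using h that by (simp add: g_def)
  define N where "N = h ` C"
  have gN: "g z \<in> C" and hg: "h (g z) = z" if "z \<in> N" for z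
    using that gh by (auto simp: N_def)
  have gM: "g z \<in> M" if "z \<in> N" for z using gN[OF that] CM by blast
  define d' where "d' x y = d (g x) (g y)" for x y
  define \<sigma>' where "\<sigma>' a = h \<circ> \<sigma> a \<circ> g" for a
  have maps': "\<sigma>' a \<in> N \<rightarrow> N" for a
    using gN Cmaps by (auto simp: \<sigma>'_def N_def)
  have g\<sigma>': "g (\<sigma>' a z) = \<sigma> a (g z)" if "z \<in> N" for a z
    using gN[OF that] Cmaps by (simp add: \<sigma>'_def gh)
  interpret N: Metric_space N d'
  proof
    fix x y z
    show "0 \<le> d' x y" "d' x y = d' y x" by (simp_all add: d'_def commute)
    show "d' x y = 0 \<longleftrightarrow> x = y" if "x \<in> N" "y \<in> N"
      using that gM hg by (metis d'_def zero)
    show "d' x z \<le> d' x y + d' y z" if "x \<in> N" "y \<in> N" "z \<in> N"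
      using that gM triangle by (simp add: d'_def)
  qed
  have "N.mcomplete"
    unfolding N.mcomplete_def
  proof (intro allI impI)
    fix y assume y: "N.MCauchy y"
    then have yN: "y n \<in> N" for n by (auto simp: N.MCauchy_def)
    have "MCauchy (g \<circ> y)"
      using y gM by (auto simp: N.MCauchy_def MCauchy_def d'_def)
    then obtain l where l: "limitin mtopology (g \<circ> y) l sequentially"
      using comp by (auto simp: mcomplete_def)
    have lC: "l \<in> C"
      using limitin_closedin[OF l, of C] gN yN by (simp add: C_def)
    have hl: "h l \<in> N" using lC by (simp add: N_def)
    have "limitin N.mtopology y (h l) sequentially"
      using l hl yN gM gh[OF lC] by (simp add: limitin_metric N.limitin_metric d'_def)
    then show "\<exists>x. limitin N.mtopology y x sequentially" by blast
  qed
  moreover have "contraction N d' (\<sigma>' a)" for a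
    unfolding contraction_def
  proof (intro conjI exI[of _ c] ballI)
    fix x y assume "x \<in> N" "y \<in> N"
    then show "d' (\<sigma>' a x) (\<sigma>' a y) \<le> c * d' x y"
      using con gM by (simp add: d'_def g\<sigma>')
  qed (use c maps' in auto)
  ultimately have sys': "contraction_system N d' \<sigma>'"
    using pC N.Metric_space_axioms by (auto simp: contraction_system_def N_def)

  have "sigma_omega M d \<sigma> s = g (sigma_omega N d' \<sigma>' s)" for s
  proof (rule sigma_omega_eqI[OF sys p])
    define q where "q = h p"
    have q: "q \<in> N" "g q = p" using pC gh by (simp_all add: q_def N_def)
    note inN = foldr_in_space[of \<sigma>', OF maps' q(1)]
    have fold: "g (foldr \<sigma>' w q) = foldr \<sigma> w p" for w
      by (induction w) (simp_all add: q(2) g\<sigma>' inN)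
    show "limitin mtopology (\<lambda>n. foldr \<sigma> (map s [0..<n]) p) (g (sigma_omega N d' \<sigma>' s)) sequentially"
      using sigma_omega_limitin[OF sys' q(1), of s] gM inM[OF p]
      by (simp add: limitin_metric N.limitin_metric d'_def fold inN)
  qed
  then have img: "fractal M d \<sigma> e = g ` fractal N d' \<sigma>' e" for e
    by (simp add: fractal_def image_image)
  then show ?thesis
    using equiv sys' unfolding fractal_equiv_def img by simp
qed


end

theory Submission
  imports Defs
begin

text \<open>On the Cantor space of streams with the maps \<open>s \<mapsto> a s\<close>, the fractal of \<open>e\<close> is \<open>str e\<close>, so fractal
  equivalence gives \<open>str e = str f\<close>. Process terms have no deadlocks, so \<open>str e\<close> and the set of finite
  traces of \<open>e\<close> determine each other, which avoids a compactness argument.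

  By the fixpoint rule, a process term is provably the sum of its transitions, and only finitely many
  terms are reachable from it. By DS, sums over sets \<open>S\<close> of reachable terms satisfy the subset
  construction: \<open>\<Sum>S \<equiv> \<Sum>\<^sub>a a (\<Sum>S\<^sub>a)\<close>, where \<open>S\<^sub>a\<close> is the set of \<open>a\<close>-successors of \<open>S\<close>. For
  trace-equivalent pairs \<open>(S, T)\<close>, the families \<open>\<Sum>S\<close> and \<open>\<Sum>T\<close> hence solve the same finite deterministic
  system. Every family \<open>G\<close> of process terms solving such a system provably equals the term obtained by
  unravelling the system into nested \<open>Mu\<close>s, one at the first visit of each state: substituting \<open>G\<close> for
  the variables of the states visited so far, UA applies to the next \<open>Mu\<close> by the induction hypothesis
  on the number of unvisited states. Only process terms are ever substituted, so no binder is renamed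
  and no equational reasoning with open terms is needed.\<close>

section \<open>Substituting process terms\<close>

text \<open>Values that are closed or the variable itself leave nothing to capture, and this class
  is preserved when a substitution passes under a binder. The set \<open>X\<close> is there because
  values off the free variables are arbitrary.\<close>

definition closing :: "(nat \<Rightarrow> 'a trm) \<Rightarrow> nat set \<Rightarrow> bool" where
  "closing s X \<longleftrightarrow> (\<forall>x\<in>X. s x = Var x \<or> s x \<in> process_terms)"

lemma closing_mono: "closing s X \<Longrightarrow> Y \<subseteq> X \<Longrightarrow> closing s Y"
  by (auto simp: closing_def)

lemma closing_upd_Var: "closing s (X - {v}) \<Longrightarrow> closing (s(v := Var v)) X"
  by (auto simp: closing_def)

lemma closing_fv: "closing s X \<Longrightarrow> x \<in> X \<Longrightarrow> fv (s x) \<subseteq> {x}"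
  by (auto simp: closing_def process_terms_def)

text \<open>For \<open>x\<close> other than \<open>v\<close>, at most \<open>x\<close> is free in
  \<open>s x\<close>, so the renaming branch of \<open>psubst\<close> is never taken.\<close>

lemma psubst_Mu:
  assumes "closing s (fv e - {v})"
  shows "psubst s (Mu v e) = Mu v (psubst (s(v := Var v)) e)"
proof -
  have "v \<notin> (\<Union>x \<in> fv e - {v}. fv (s x))"
    using closing_fv[OF assms] by blast
  then show ?thesis by (simp add: Let_def)
qed

lemma psubst_cong_fv: "(\<And>x. x \<in> fv e \<Longrightarrow> s x = t x) \<Longrightarrow> psubst s e = psubst t e"
proof (induction e arbitrary: s t)
  case (Mu v e)
  have X: "(\<Union>x \<in> fv e - {v}. fv (s x)) = (\<Union>x \<in> fv e - {v}. fv (t x))"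
    using Mu.prems by auto
  have "psubst (s(v := Var w)) e = psubst (t(v := Var w)) e" for w
    by (rule Mu.IH) (use Mu.prems in auto)
  then show ?case by (simp add: X Let_def)
next
  case (Sum e1 e2)
  have "psubst s e1 = psubst t e1" by (rule Sum.IH(1)) (simp add: Sum.prems)
  moreover have "psubst s e2 = psubst t e2" by (rule Sum.IH(2)) (simp add: Sum.prems)
  ultimately show ?case by simp
next
  case (Pre a e)
  have "psubst s e = psubst t e" by (rule Pre.IH) (simp add: Pre.prems)
  then show ?case by simp
qed simp

lemma psubst_Var: "psubst Var e = e"
proof (induction e)
  case (Mu v e)
  have "Var(v := Var v) = Var" by auto
  then show ?case using Mu by simp
qed auto

lemma psubst_closed: "fv e = {} \<Longrightarrow> psubst s e = e"
  using psubst_cong_fv[of e s Var] by (simp add: psubst_Var)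

lemma fv_psubst: "closing s (fv e) \<Longrightarrow> fv (psubst s e) = (\<Union>x\<in>fv e. fv (s x))"
proof (induction e arbitrary: s)
  case (Mu v e)
  have c: "closing s (fv e - {v})" using Mu.prems by simp
  have "fv (psubst s (Mu v e)) = (\<Union>x\<in>fv e. fv ((s(v := Var v)) x)) - {v}"
    unfolding psubst_Mu[OF c] by (simp add: Mu.IH[OF closing_upd_Var[OF c]])
  also have "\<dots> = (\<Union>x\<in>fv e - {v}. fv (s x))"
  proof -
    have "v \<notin> fv (s x)" if "x \<in> fv e - {v}" for x
      using closing_fv[OF c that] that by blast
    then show ?thesis by (auto split: if_splits)
  qed
  finally show ?case by simp
qed (auto simp: closing_def)

lemma unguarded_fv_subset_fv: "unguarded_fv e \<subseteq> fv e"
  by (induction e) auto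

lemma unguarded_fv_psubst: "closing s (fv e) \<Longrightarrow> unguarded_fv (psubst s e) \<subseteq> unguarded_fv e"
proof (induction e arbitrary: s)
  case (Var v)
  then show ?case using unguarded_fv_subset_fv[of "s v"] closing_fv[of s "{v}" v] by auto
next
  case (Mu v e)
  have c: "closing s (fv e - {v})" using Mu.prems by simp
  have "unguarded_fv (psubst (s(v := Var v)) e) \<subseteq> unguarded_fv e"
    by (rule Mu.IH[OF closing_upd_Var[OF c]])
  then show ?case unfolding psubst_Mu[OF c] by auto
next
  case (Sum e1 e2)
  then have "closing s (fv e1)" "closing s (fv e2)" by (auto simp: closing_def)
  then show ?case unfolding psubst.simps unguarded_fv.simps by (intro Un_mono Sum.IH)
qed (auto simp: closing_def)

lemma guarded_psubst: "closing s (fv e) \<Longrightarrow> guarded e \<Longrightarrow> guarded (psubst s e)"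
proof (induction e arbitrary: s)
  case (Mu v e)
  have c: "closing s (fv e - {v})" using Mu.prems by simp
  have "guarded (psubst (s(v := Var v)) e)"
    by (rule Mu.IH[OF closing_upd_Var[OF c]]) (use Mu.prems(2) in simp)
  moreover have "unguarded_fv (psubst (s(v := Var v)) e) \<subseteq> unguarded_fv e"
    by (rule unguarded_fv_psubst[OF closing_upd_Var[OF c]])
  ultimately show ?case unfolding psubst_Mu[OF c] using Mu.prems(2) by auto
qed (auto simp: closing_def process_terms_def)

lemma process_terms_psubst:
  assumes "\<And>x. x \<in> fv e \<Longrightarrow> s x \<in> process_terms" "guarded e"
  shows "psubst s e \<in> process_terms"
proof -
  have c: "closing s (fv e)" using assms(1) by (simp add: closing_def)
  show ?thesis
    using fv_psubst[OF c] guarded_psubst[OF c assms(2)] assms(1) by (simp add: process_terms_def)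
qed

text \<open>No binder is renamed by either substitution, so they compose up to syntactic equality
  and not merely up to AE.\<close>

lemma psubst_psubst:
  "closing s (fv e) \<Longrightarrow> closing r (fv e) \<Longrightarrow>
    psubst r (psubst s e) = psubst (\<lambda>x. psubst r (s x)) e"
proof (induction e arbitrary: s r)
  case (Mu v e)
  have cs: "closing s (fv e - {v})" and cr: "closing r (fv e - {v})" using Mu.prems by simp_all
  let ?s = "s(v := Var v)" and ?r = "r(v := Var v)" and ?t = "\<lambda>x. psubst r (s x)"
  have ct: "closing ?t (fv e - {v})"
    unfolding closing_def
  proof
    fix x assume x: "x \<in> fv e - {v}"
    then consider "s x = Var x" | "s x \<in> process_terms" using cs by (auto simp: closing_def)
    then show "?t x = Var x \<or> ?t x \<in> process_terms"
    proof cases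
      case 1 then show ?thesis using cr x by (auto simp: closing_def)
    next
      case 2 then show ?thesis by (simp add: process_terms_def psubst_closed)
    qed
  qed
  have "fv (psubst ?s e) \<subseteq> fv e"
    using closing_fv[OF closing_upd_Var[OF cs]] by (fastforce simp: fv_psubst[OF closing_upd_Var[OF cs]])
  then have c: "closing r (fv (psubst ?s e) - {v})" by (intro closing_mono[OF cr]) blast
  have "psubst r (psubst s (Mu v e)) = Mu v (psubst ?r (psubst ?s e))"
    by (simp only: psubst_Mu[OF cs] psubst_Mu[OF c])
  also have "psubst ?r (psubst ?s e) = psubst (\<lambda>x. psubst ?r (?s x)) e"
    by (rule Mu.IH[OF closing_upd_Var[OF cs] closing_upd_Var[OF cr]])
  also have "\<dots> = psubst (?t(v := Var v)) e"
  proof (rule psubst_cong_fv)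
    fix x assume x: "x \<in> fv e"
    show "psubst ?r (?s x) = (?t(v := Var v)) x"
    proof (cases "x = v")
      case False
      have "psubst ?r (s x) = psubst r (s x)"
        by (rule psubst_cong_fv) (use closing_fv[OF cs, of x] x False in auto)
      then show ?thesis using False by simp
    qed simp
  qed
  finally show ?case by (simp only: psubst_Mu[OF ct])
qed (auto simp: closing_def)

text \<open>Brings the unfolding of a recursion, both in transitions and in the premise of UA, into
  the form of one simultaneous substitution. The other values of \<open>s\<close> do not mention
  \<open>v\<close>, so inserting \<open>g\<close> leaves them alone.\<close>

lemma subst_psubst_upd:
  assumes s: "closing s (fv e - {v})" and g: "g \<in> process_terms"
  shows "(psubst (s(v := Var v)) e)[g/v] = psubst (s(v := g)) e"
proof -
  have "(psubst (s(v := Var v)) e)[g/v] = psubst (\<lambda>x. psubst (Var(v := g)) ((s(v := Var v)) x)) e"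
    unfolding subst_def by (rule psubst_psubst[OF closing_upd_Var[OF s]]) (use g in \<open>auto simp: closing_def\<close>)
  also have "\<dots> = psubst (s(v := g)) e"
  proof (rule psubst_cong_fv)
    fix x assume x: "x \<in> fv e"
    show "psubst (Var(v := g)) ((s(v := Var v)) x) = (s(v := g)) x"
    proof (cases "x = v")
      case False
      then have "s x = Var x \<or> fv (s x) = {}"
        using s x by (auto simp: closing_def process_terms_def)
      then show ?thesis using False by (auto simp: psubst_closed)
    qed simp
  qed
  finally show ?thesis .
qed

lemma subst_process_terms:
  assumes "Mu v e \<in> process_terms"
  shows "e[Mu v e/v] \<in> process_terms"
  unfolding subst_def
  by (rule process_terms_psubst) (use assms in \<open>auto simp: process_terms_def\<close>)

text \<open>Unfolding a guarded recursion does not change this depth, which makes it a termination measure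
  for the transitions.\<close>

primrec unguarded_depth :: "'a trm \<Rightarrow> nat" where
  "unguarded_depth (Var v) = 0"
| "unguarded_depth (Pre a e) = 0"
| "unguarded_depth (Sum e1 e2) = Suc (unguarded_depth e1 + unguarded_depth e2)"
| "unguarded_depth (Mu v e) = Suc (unguarded_depth e)"

lemma unguarded_depth_psubst:
  "closing s (fv e) \<Longrightarrow> (\<And>x. x \<in> unguarded_fv e \<Longrightarrow> s x = Var x) \<Longrightarrow>
    unguarded_depth (psubst s e) = unguarded_depth e"
proof (induction e arbitrary: s)
  case (Mu v e)
  have c: "closing s (fv e - {v})" using Mu.prems by simp
  have "unguarded_depth (psubst (s(v := Var v)) e) = unguarded_depth e"
    by (rule Mu.IH[OF closing_upd_Var[OF c]]) (use Mu.prems in auto)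
  then show ?case by (simp add: psubst_Mu[OF c] del: psubst.simps)
next
  case (Sum e1 e2)
  have "closing s (fv e1)" "closing s (fv e2)" using Sum.prems by (auto simp: closing_def)
  then show ?case using Sum by simp
qed auto

text \<open>Induction along the transition rules: a recursion is reduced to its unfolding, whose
  depth is that of its body and thus smaller. The prefix case has no hypothesis for the body because
  the depth of a prefix is 0.\<close>

lemma process_term_induct [consumes 1, case_names Pre Sum Mu]:
  assumes "e \<in> process_terms"
    and Pre: "\<And>a e. e \<in> process_terms \<Longrightarrow> Q (Pre a e)"
    and Sum: "\<And>e1 e2. e1 \<in> process_terms \<Longrightarrow> e2 \<in> process_terms \<Longrightarrow> Q e1 \<Longrightarrow> Q e2 \<Longrightarrow> Q (Sum e1 e2)"
    and Mu: "\<And>v e. Mu v e \<in> process_terms \<Longrightarrow> Q (e[Mu v e/v]) \<Longrightarrow> Q (Mu v e)"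
  shows "Q e"
  using assms(1)
proof (induction "unguarded_depth e" arbitrary: e rule: less_induct)
  case less
  show ?case
  proof (cases e)
    case (Var v)
    then show ?thesis using less.prems by (simp add: process_terms_def)
  next
    case (Pre a g)
    then show ?thesis using less.prems by (auto simp: process_terms_def intro: assms(2))
  next
    case (Sum e1 e2)
    then show ?thesis using less
      by (auto simp: process_terms_def intro!: assms(3))
  next
    case (Mu v g)
    have P: "Mu v g \<in> process_terms" using less.prems Mu by simp
    have "unguarded_depth (g[Mu v g/v]) = unguarded_depth g"
      unfolding subst_def
      by (rule unguarded_depth_psubst) (use P in \<open>auto simp: closing_def process_terms_def\<close>)
    then have "Q (g[Mu v g/v])"
      using less.hyps[of "g[Mu v g/v]"] subst_process_terms[OF P] Mu by simp
    then show ?thesis using assms(4)[OF P] Mu by simp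
  qed
qed


section \<open>Transitions and traces\<close>

inductive_simps step_Pre_iff: "step (Pre a e) b f"
inductive_simps step_Sum_iff: "step (Sum e1 e2) b f"
inductive_simps step_Mu_iff: "step (Mu v e) b f"

lemma step_process_terms:
  assumes "e \<in> process_terms" "step e a f"
  shows "f \<in> process_terms"
  using assms by (induction rule: process_term_induct)
    (auto simp: step_Pre_iff step_Sum_iff step_Mu_iff)

text \<open>There is no term for the empty process, and by guardedness repeated unfolding reaches a
  prefix; hence no deadlock.\<close>

lemma step_total: "e \<in> process_terms \<Longrightarrow> \<exists>a f. step e a f"
proof (induction rule: process_term_induct)
  case (Mu v e) then show ?case by (simp add: step_Mu_iff)
qed (auto simp: step_Pre_iff step_Sum_iff)

section \<open>Finiteness of the reachable terms\<close>

text \<open>\<open>s\<close> carries the closed instance of each enclosing recursion, so these are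
  the subterms with bound variables replaced by their recursions. A bound variable adds nothing, as
  its value is recorded at its binder.\<close>

primrec subterm_instances :: "'a trm \<Rightarrow> (nat \<Rightarrow> 'a trm) \<Rightarrow> 'a trm set" where
  "subterm_instances (Var v) s = {}"
| "subterm_instances (Pre a e) s = insert (psubst s (Pre a e)) (subterm_instances e s)"
| "subterm_instances (Sum e1 e2) s =
    insert (psubst s (Sum e1 e2)) (subterm_instances e1 s \<union> subterm_instances e2 s)"
| "subterm_instances (Mu v e) s =
    insert (psubst s (Mu v e)) (subterm_instances e (s(v := psubst s (Mu v e))))"

lemma finite_subterm_instances: "finite (subterm_instances e s)"
  by (induction e arbitrary: s) auto

lemma psubst_in_subterm_instances:
  "psubst s e \<in> subterm_instances e s \<or> (\<exists>v. e = Var v)"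
  by (cases e) auto

lemma step_psubst_Mu:
  assumes "closing s (fv e - {v})" "psubst s (Mu v e) \<in> process_terms"
  shows "step (psubst s (Mu v e)) a f \<longleftrightarrow> step (psubst (s(v := psubst s (Mu v e))) e) a f"
  using subst_psubst_upd[OF assms] by (simp only: psubst_Mu[OF assms(1)] step_Mu_iff)

text \<open>A transition starts at a prefix or at the value of an unguarded variable. Successors of
  other values are left unrestricted, since in the \<open>Mu\<close> case those of the new value
  \<open>m\<close> are what is to be established.\<close>

lemma step_psubst:
  assumes "guarded e" "\<And>x. x \<in> fv e \<Longrightarrow> s x \<in> process_terms \<inter> R"
    "\<And>x a f. x \<in> unguarded_fv e \<Longrightarrow> step (s x) a f \<Longrightarrow> f \<in> R"
    "subterm_instances e s \<subseteq> R" "step (psubst s e) a f"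
  shows "f \<in> R"
  using assms
proof (induction e arbitrary: s)
  case (Pre b e)
  have "f = psubst s e" using Pre.prems(5) by (simp add: step_Pre_iff)
  then show ?case using psubst_in_subterm_instances[of s e] Pre.prems(2,4) by auto
next
  case (Sum e1 e2)
  from Sum.prems(5) consider "step (psubst s e1) a f" | "step (psubst s e2) a f"
    by (auto simp: step_Sum_iff)
  then show ?case
    by cases (use Sum.IH[of s] Sum.prems in auto)
next
  case (Mu v e)
  define m where "m = psubst s (Mu v e)"
  have c: "closing s (fv e - {v})" using Mu.prems(2) by (auto simp: closing_def)
  have m: "m \<in> process_terms"
    unfolding m_def by (rule process_terms_psubst) (use Mu.prems in auto)
  have step: "step (psubst (s(v := m)) e) a f"
    using Mu.prems(5) step_psubst_Mu[OF c] m by (simp add: m_def)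
  have sub: "subterm_instances e (s(v := m)) \<subseteq> R" and "m \<in> R"
    using Mu.prems(4) by (simp_all add: m_def del: psubst.simps)
  then show ?case
    by (intro Mu.IH[OF _ _ _ sub step]) (use Mu.prems(1-3) m in \<open>auto split: if_splits\<close>)
qed auto

lemma step_subterm_instances:
  assumes "guarded e" "\<And>x. x \<in> fv e \<Longrightarrow> s x \<in> process_terms \<inter> R"
    "\<And>x a f. x \<in> fv e \<Longrightarrow> step (s x) a f \<Longrightarrow> f \<in> R"
    "subterm_instances e s \<subseteq> R" "g \<in> subterm_instances e s"
  shows "g \<in> process_terms \<and> (\<forall>a f. step g a f \<longrightarrow> f \<in> R)"
  using assms
proof (induction e arbitrary: s)
  case (Pre b e)
  show ?case
  proof (cases "g = psubst s (Pre b e)")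
    case True
    then show ?thesis
      using step_psubst[OF Pre.prems(1,2) _ Pre.prems(4)] process_terms_psubst[OF _ Pre.prems(1)] Pre.prems(2)
      by auto
  next
    case False then show ?thesis using Pre.IH[of s] Pre.prems by simp
  qed
next
  case (Sum e1 e2)
  show ?case
  proof (cases "g = psubst s (Sum e1 e2)")
    case True
    have "f \<in> R" if "step g a f" for a f
      by (rule step_psubst[OF Sum.prems(1,2) _ Sum.prems(4)])
        (use that True Sum.prems(3) unguarded_fv_subset_fv in \<open>blast+\<close>)
    then show ?thesis
      using process_terms_psubst[OF _ Sum.prems(1)] Sum.prems(2) True by blast
  next
    case False
    then consider "g \<in> subterm_instances e1 s" | "g \<in> subterm_instances e2 s"
      using Sum.prems(5) by auto
    then show ?thesis
    proof cases
      case 1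
      show ?thesis by (rule Sum.IH(1)[OF _ _ _ _ 1]) (use Sum.prems in auto)
    next
      case 2
      show ?thesis by (rule Sum.IH(2)[OF _ _ _ _ 2]) (use Sum.prems in auto)
    qed
  qed
next
  case (Mu v e)
  define m where "m = psubst s (Mu v e)"
  have m: "m \<in> process_terms"
    unfolding m_def by (rule process_terms_psubst) (use Mu.prems in auto)
  \<comment> \<open>\<open>step_psubst\<close> treats the successors of \<open>m\<close> without
    circularity; this supplies the hypothesis on \<open>v\<close> that is needed under the
    binder.\<close>
  have step_m: "f \<in> R" if "step m a f" for a f
    by (rule step_psubst[OF Mu.prems(1,2) _ Mu.prems(4)])
      (use that Mu.prems(3) unguarded_fv_subset_fv in \<open>unfold m_def, blast+\<close>)
  show ?case
  proof (cases "g = m")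
    case True then show ?thesis using m step_m by blast
  next
    case False
    then have g: "g \<in> subterm_instances e (s(v := m))"
      using Mu.prems(5) by (simp add: m_def del: psubst.simps)
    have sub: "subterm_instances e (s(v := m)) \<subseteq> R" and "m \<in> R"
      using Mu.prems(4) by (simp_all add: m_def del: psubst.simps)
    then show ?thesis
      by (intro Mu.IH[OF _ _ _ sub g]) (use Mu.prems(1-3) m step_m in \<open>auto split: if_splits\<close>)
  qed
qed auto

lemma finite_reachable:
  assumes e: "e \<in> process_terms"
  obtains R where "finite R" "e \<in> R" "R \<subseteq> process_terms"
    "\<And>g a f. g \<in> R \<Longrightarrow> step g a f \<Longrightarrow> f \<in> R"
proof
  let ?R = "subterm_instances e Var"
  have e': "guarded e" "fv e = {}" using e by (auto simp: process_terms_def)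
  have *: "g \<in> process_terms \<and> (\<forall>a f. step g a f \<longrightarrow> f \<in> ?R)" if "g \<in> ?R" for g
    by (rule step_subterm_instances[OF e'(1) _ _ _ that]) (use e'(2) in auto)
  show "finite ?R" by (rule finite_subterm_instances)
  show "e \<in> ?R" using psubst_in_subterm_instances[of Var e] e'(2) by (auto simp: psubst_Var)
  show "?R \<subseteq> process_terms" using * by blast
  show "\<And>g a f. g \<in> ?R \<Longrightarrow> step g a f \<Longrightarrow> f \<in> ?R" using * by blast
qed

section \<open>Finite traces and infinite streams\<close>

definition traces :: "'a trm \<Rightarrow> 'a list set" where
  "traces e = {w. \<exists>f. steps e w f}"

lemma Cons_in_traces: "a # w \<in> traces e \<longleftrightarrow> (\<exists>f. step e a f \<and> w \<in> traces f)"
  unfolding traces_def mem_Collect_eq steps.simps by blast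

lemma Nil_in_traces: "[] \<in> traces e"
  unfolding traces_def mem_Collect_eq steps.simps by blast

lemma str_altdef: "str e = {s. \<forall>n. map s [0..<n] \<in> traces e}"
  by (simp add: str_def traces_def)

lemma str_Cons:
  assumes "step e a f" "s \<in> str f"
  shows "case_nat a s \<in> str e"
proof -
  have "map (case_nat a s) [0..<n] \<in> traces e" for n
  proof (cases n)
    case (Suc m)
    have "map (case_nat a s) [0..<n] = a # map s [0..<m]"
      unfolding Suc map_upt_Suc by simp
    then show ?thesis using assms by (auto simp: str_altdef Cons_in_traces)
  qed (simp add: Nil_in_traces)
  then show ?thesis by (simp add: str_altdef)
qed

lemma str_nonempty:
  assumes "e \<in> process_terms"
  shows "str e \<noteq> {}"
proof -
  \<comment> \<open>\<open>nxt\<close> chooses a transition, as label and target, for each term;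
    \<open>st g n\<close> is the term reached from \<open>g\<close> after \<open>n\<close> chosen
    transitions.\<close>
  define nxt where "nxt g = (SOME p. step g (fst p) (snd p))" for g :: "'a trm"
  define st where "st g n = ((snd \<circ> nxt) ^^ n) g" for g n
  have nxt: "step g (fst (nxt g)) (snd (nxt g))" if "g \<in> process_terms" for g
    unfolding nxt_def by (rule someI_ex) (use step_total[OF that] in auto)
  have "map (\<lambda>n. fst (nxt (st g n))) [0..<n] \<in> traces g" if "g \<in> process_terms" for g n
    using that
  proof (induction n arbitrary: g)
    case (Suc n)
    let ?h = "snd (nxt g)"
    have "st ?h n = st g (Suc n)" for n by (simp add: st_def funpow_swap1)
    then have "map (\<lambda>n. fst (nxt (st g n))) [0..<Suc n] =
        fst (nxt g) # map (\<lambda>n. fst (nxt (st ?h n))) [0..<n]"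
      unfolding map_upt_Suc by (simp add: st_def)
    moreover have "map (\<lambda>n. fst (nxt (st ?h n))) [0..<n] \<in> traces ?h"
      using step_process_terms[OF Suc.prems nxt[OF Suc.prems]] by (rule Suc.IH)
    ultimately show ?case
      using nxt[OF Suc.prems] by (simp only: Cons_in_traces) blast
  qed (simp add: Nil_in_traces)
  then have "(\<lambda>n. fst (nxt (st e n))) \<in> str e" using assms by (simp add: str_altdef)
  then show ?thesis by blast
qed

text \<open>The path ends in a process term, which has an infinite run, and the stream of that run
  can be appended.\<close>

lemma traces_extend_to_str:
  assumes "e \<in> process_terms" "w \<in> traces e"
  shows "\<exists>s\<in>str e. w = map s [0..<length w]"
  using assms
proof (induction w arbitrary: e)
  case Nil then show ?case using str_nonempty by auto
next
  case (Cons a w)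
  then obtain f where f: "step e a f" "w \<in> traces f" by (auto simp: Cons_in_traces)
  then obtain s where s: "s \<in> str f" "w = map s [0..<length w]"
    using Cons.IH step_process_terms[OF Cons.prems(1)] by blast
  have "a # w = map (case_nat a s) [0..<length (a # w)]"
    using s(2) by (simp add: map_upt_Suc del: upt_Suc)
  then show ?case by (rule bexI[OF _ str_Cons[OF f(1) s(1)]])
qed

lemma traces_eq_prefixes:
  assumes "e \<in> process_terms"
  shows "traces e = {map s [0..<n] |s n. s \<in> str e}"
  using traces_extend_to_str[OF assms] by (fastforce simp: str_altdef)


section \<open>Fractal equivalence implies equality of streams\<close>

definition cantor_dist :: "(nat \<Rightarrow> 'a) \<Rightarrow> (nat \<Rightarrow> 'a) \<Rightarrow> real" where
  "cantor_dist s t = (if s = t then 0 else (1/2) ^ (LEAST n. s n \<noteq> t n))"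

text \<open>Translates metric estimates into agreement of prefixes, the form used for the triangle
  inequality, limits, completeness and contraction.\<close>

lemma cantor_dist_le_iff:
  "cantor_dist s t \<le> (1/2) ^ n \<longleftrightarrow> (\<forall>i<n. s i = t i)"
proof (cases "s = t")
  case False
  then obtain k where k: "s k \<noteq> t k" by blast
  let ?k = "LEAST n. s n \<noteq> t n"
  have "cantor_dist s t \<le> (1/2) ^ n \<longleftrightarrow> n \<le> ?k"
    using False by (simp add: cantor_dist_def)
  also have "\<dots> \<longleftrightarrow> (\<forall>i<n. s i = t i)"
    using LeastI[of "\<lambda>n. s n \<noteq> t n", OF k] not_less_Least[of _ "\<lambda>n. s n \<noteq> t n"]
    by (metis not_less order_less_le_trans)
  finally show ?thesis .
qed (simp add: cantor_dist_def)

lemma cantor_dist_cases: "cantor_dist s t = 0 \<or> (\<exists>n. cantor_dist s t = (1/2) ^ n)"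
  by (auto simp: cantor_dist_def)

lemma cantor_dist_nonneg: "0 \<le> cantor_dist s t"
  by (simp add: cantor_dist_def)

lemma cantor_dist_eq_0_iff: "cantor_dist s t = 0 \<longleftrightarrow> s = t"
  by (simp add: cantor_dist_def)

lemma cantor_dist_commute: "cantor_dist s t = cantor_dist t s"
  unfolding cantor_dist_def eq_commute[of "t _"] by (simp add: eq_commute)

text \<open>The larger distance is 0 or a power of 1/2, so it amounts to agreement on a prefix, and
  such agreement is transitive.\<close>

lemma cantor_dist_triangle: "cantor_dist r t \<le> max (cantor_dist r s) (cantor_dist s t)"
proof -
  have "max (cantor_dist r s) (cantor_dist s t) = 0 \<or>
      (\<exists>n. max (cantor_dist r s) (cantor_dist s t) = (1/2) ^ n)"
    using cantor_dist_cases[of r s] cantor_dist_cases[of s t] by (auto simp: max_def)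
  then show ?thesis
  proof (elim disjE exE)
    assume "max (cantor_dist r s) (cantor_dist s t) = 0"
    then have "cantor_dist r s = 0" "cantor_dist s t = 0"
      using cantor_dist_nonneg by (smt (verit))+
    then show ?thesis by (simp add: cantor_dist_eq_0_iff)
  next
    fix n assume n: "max (cantor_dist r s) (cantor_dist s t) = (1/2) ^ n"
    then have "cantor_dist r s \<le> (1/2) ^ n" "cantor_dist s t \<le> (1/2) ^ n" by linarith+
    then have "cantor_dist r t \<le> (1/2) ^ n" by (simp add: cantor_dist_le_iff)
    then show ?thesis by (simp add: n)
  qed
qed

interpretation cantor: Metric_space UNIV cantor_dist
proof
  fix r s t :: "nat \<Rightarrow> 'a"
  show "cantor_dist r t \<le> cantor_dist r s + cantor_dist s t"
    using cantor_dist_triangle[of r t s] cantor_dist_nonneg[of r s] cantor_dist_nonneg[of s t] by linarith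
qed (simp_all add: cantor_dist_nonneg cantor_dist_eq_0_iff cantor_dist_commute)

lemma limitin_cantor:
  assumes "\<And>n i. i < n \<Longrightarrow> y n i = l i"
  shows "limitin cantor.mtopology y l sequentially"
  unfolding cantor.limitin_metric_dist_null
proof (intro conjI)
  have "cantor_dist (y n) l \<le> (1/2) ^ n" for n
    using assms by (simp add: cantor_dist_le_iff)
  then show "(\<lambda>n. cantor_dist (y n) l) \<longlonglongrightarrow> 0"
    by (intro tendsto_sandwich[OF _ _ tendsto_const LIMSEQ_realpow_zero[of "1/2"]])
      (simp_all add: cantor_dist_nonneg)
qed simp_all

lemma cantor_mcomplete: "cantor.mcomplete TYPE('a)"
  unfolding cantor.mcomplete_def
proof (intro allI impI)
  fix y :: "nat \<Rightarrow> nat \<Rightarrow> 'a" assume "cantor.MCauchy y"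
  then have "\<exists>N. \<forall>m\<ge>N. \<forall>k\<ge>N. cantor_dist (y m) (y k) < (1/2) ^ n" for n
    unfolding cantor.MCauchy_def by (auto dest: spec[of _ "(1/2) ^ n"])
  then obtain N where N: "\<And>n m k. m \<ge> N n \<Longrightarrow> k \<ge> N n \<Longrightarrow> cantor_dist (y m) (y k) < (1/2) ^ n"
    by metis
  have agree: "y m i = y k i" if "m \<ge> N n" "k \<ge> N n" "i < n" for m k n i
    using N[OF that(1,2)] cantor_dist_le_iff[of "y m" "y k" n] that(3) by simp
  \<comment> \<open>From index \<open>N (Suc i)\<close> on, entry \<open>i\<close> no longer
    changes.\<close>
  define l where "l i = y (N (Suc i)) i" for i
  \<comment> \<open>\<open>N\<close> need not be monotone, so both sides are compared at index
    \<open>max (N n) (N (Suc i))\<close>.\<close>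
  have yl: "y m i = l i" if "m \<ge> N n" "i < n" for m n i
    using agree[where n = n and m = m and k = "max (N n) (N (Suc i))" and i = i]
      agree[where n = "Suc i" and m = "N (Suc i)" and k = "max (N n) (N (Suc i))" and i = i] that
    by (simp add: l_def)
  have "limitin cantor.mtopology y l sequentially"
    unfolding cantor.limitin_metric
  proof (intro conjI allI impI)
    fix \<epsilon> :: real assume "\<epsilon> > 0"
    then obtain n where n: "(1/2) ^ n < \<epsilon>" using real_arch_pow_inv[of \<epsilon> "1/2"] by auto
    have "cantor_dist (y m) l \<le> (1/2) ^ n" if "m \<ge> N n" for m
      using yl[OF that] by (simp add: cantor_dist_le_iff)
    then show "\<forall>\<^sub>F m in sequentially. y m \<in> UNIV \<and> cantor_dist (y m) l < \<epsilon>"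
      using n by (auto simp: eventually_sequentially intro: le_less_trans exI[of _ "N n"])
  qed simp
  then show "\<exists>l. limitin cantor.mtopology y l sequentially" by blast
qed

text \<open>Prepending an action moves the first disagreement one place later, which halves the
  distance.\<close>

lemma contraction_system_cantor: "contraction_system UNIV cantor_dist (\<lambda>a s. case_nat a s)"
proof -
  have "cantor_dist (case_nat a s) (case_nat a t) \<le> 1/2 * cantor_dist s t" for a :: 'a and s t
  proof (cases "s = t")
    case False
    then obtain n where n: "cantor_dist s t = (1/2) ^ n"
      using cantor_dist_cases cantor_dist_eq_0_iff by blast
    then have "\<forall>i<n. s i = t i" using cantor_dist_le_iff[of s t n] by simp
    then have "cantor_dist (case_nat a s) (case_nat a t) \<le> (1/2) ^ Suc n"
      unfolding cantor_dist_le_iff by (auto simp: less_Suc_eq_0_disj split: nat.split)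
    then show ?thesis by (simp add: n)
  qed (simp add: cantor_dist_def)
  then show ?thesis
    by (auto simp: contraction_system_def contraction_def cantor.Metric_space_axioms cantor_mcomplete
        intro!: exI[of _ "1/2"])
qed

lemma sigma_omega_cantor:
  fixes s :: "nat \<Rightarrow> 'a::finite"
  shows "sigma_omega UNIV cantor_dist (\<lambda>a s. case_nat a s) s = s"
proof (rule sigma_omega_eqI[OF contraction_system_cantor UNIV_I])
  have nth: "foldr (\<lambda>a s. case_nat a s) w p i = w ! i" if "i < length w" for w and p :: "nat \<Rightarrow> 'a" and i
    using that by (induction w arbitrary: i) (auto simp: less_Suc_eq_0_disj)
  show "limitin cantor.mtopology (\<lambda>n. foldr (\<lambda>a s. case_nat a s) (map s [0..<n]) s) s sequentially"
    by (rule limitin_cantor) (simp add: nth)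
qed

text \<open>\<open>fractal_equiv\<close> speaks of metrics on sets of reals;
  \<open>fractal_equiv_all\<close> transfers it to the space of streams, where
  \<open>sigma_omega\<close> is the identity.\<close>

lemma fractal_equiv_imp_str_eq:
  fixes e f :: "'a::finite trm"
  assumes "e \<approx>\<^sub>f f"
  shows "str e = str f"
  using fractal_equiv_all[OF assms contraction_system_cantor]
  by (simp add: fractal_def sigma_omega_cantor)


section \<open>Process terms as a semilattice\<close>

lemma Sum_cong:
  assumes "e1 \<equiv>\<^sub>p f1" "e2 \<equiv>\<^sub>p f2"
  shows "Sum e1 e2 \<equiv>\<^sub>p Sum f1 f2"
  using prov_equiv.CN[of "Sum (Var 0) (Var 1)" "\<lambda>v. if v = 0 then e1 else e2" "\<lambda>v. if v = 0 then f1 else f2"] assms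
  by auto

lemma Pre_cong: "e \<equiv>\<^sub>p f \<Longrightarrow> Pre a e \<equiv>\<^sub>p Pre a f"
  using prov_equiv.CN[of "Pre a (Var 0)" "\<lambda>_. e" "\<lambda>_. f"] by simp

lemma guarded_process_term: "e \<in> process_terms \<Longrightarrow> guarded e"
  by (simp add: process_terms_def)

lemma Sum_process_terms: "Sum e1 e2 \<in> process_terms \<longleftrightarrow> e1 \<in> process_terms \<and> e2 \<in> process_terms"
  by (auto simp: process_terms_def)

lemma Pre_process_terms: "Pre a e \<in> process_terms \<longleftrightarrow> e \<in> process_terms"
  by (auto simp: process_terms_def)

text \<open>The order of the join-semilattice of process terms modulo
  \<open>\<equiv>\<^sub>p\<close>. Membership is built in so that transitivity, antisymmetry and
  \<open>Sum_le_trm\<close> carry no guardedness hypotheses.\<close>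

definition le_trm :: "'a trm \<Rightarrow> 'a trm \<Rightarrow> bool"  (infix \<open>\<sqsubseteq>\<close> 50) where
  "x \<sqsubseteq> y \<longleftrightarrow> x \<in> process_terms \<and> y \<in> process_terms \<and> Sum x y \<equiv>\<^sub>p y"

lemma le_trm_equiv: "x \<equiv>\<^sub>p y \<Longrightarrow> x \<in> process_terms \<Longrightarrow> y \<in> process_terms \<Longrightarrow> x \<sqsubseteq> y"
  unfolding le_trm_def
  by (meson Sum_cong guarded_process_term prov_equiv.ID prov_equiv.refl prov_equiv.trans)

lemma le_trm_refl: "x \<in> process_terms \<Longrightarrow> x \<sqsubseteq> x"
  by (simp add: le_trm_equiv guarded_process_term prov_equiv.refl)

lemma le_trm_trans:
  assumes "x \<sqsubseteq> y" "y \<sqsubseteq> z"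
  shows "x \<sqsubseteq> z"
proof -
  have P: "x \<in> process_terms" "y \<in> process_terms" "z \<in> process_terms"
    and xy: "Sum x y \<equiv>\<^sub>p y" and yz: "Sum y z \<equiv>\<^sub>p z"
    using assms by (auto simp: le_trm_def)
  note g = P[THEN guarded_process_term]
  note [trans] = prov_equiv.trans
  have "Sum x z \<equiv>\<^sub>p Sum x (Sum y z)" by (intro Sum_cong prov_equiv.refl g prov_equiv.sym[OF yz])
  also have "\<dots> \<equiv>\<^sub>p Sum (Sum x y) z" by (intro prov_equiv.AS g)
  also have "\<dots> \<equiv>\<^sub>p Sum y z" by (intro Sum_cong prov_equiv.refl g xy)
  also note yz
  finally show ?thesis using P by (simp add: le_trm_def)
qed

lemma le_trm_antisym: "x \<sqsubseteq> y \<Longrightarrow> y \<sqsubseteq> x \<Longrightarrow> x \<equiv>\<^sub>p y"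
  unfolding le_trm_def
  by (meson guarded_process_term prov_equiv.CM prov_equiv.sym prov_equiv.trans)

lemma le_trm_Sum:
  assumes "x \<in> process_terms" "y \<in> process_terms"
  shows "x \<sqsubseteq> Sum x y" "y \<sqsubseteq> Sum x y"
proof -
  have *: "u \<sqsubseteq> Sum u v" if P: "u \<in> process_terms" "v \<in> process_terms" for u v :: "'a trm"
  proof -
    note g = P[THEN guarded_process_term]
    note [trans] = prov_equiv.trans
    have "Sum u (Sum u v) \<equiv>\<^sub>p Sum (Sum u u) v" by (intro prov_equiv.AS g)
    also have "\<dots> \<equiv>\<^sub>p Sum u v" by (intro Sum_cong prov_equiv.refl prov_equiv.ID g)
    finally show ?thesis using P by (simp add: le_trm_def Sum_process_terms)
  qed
  show "x \<sqsubseteq> Sum x y" using * assms by blast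
  have "Sum y x \<sqsubseteq> Sum x y"
    using assms by (simp add: le_trm_equiv prov_equiv.CM guarded_process_term Sum_process_terms)
  then show "y \<sqsubseteq> Sum x y" using * assms le_trm_trans by blast
qed

lemma Sum_le_trm:
  assumes "x \<sqsubseteq> z" "y \<sqsubseteq> z"
  shows "Sum x y \<sqsubseteq> z"
proof -
  have P: "x \<in> process_terms" "y \<in> process_terms" "z \<in> process_terms"
    and xz: "Sum x z \<equiv>\<^sub>p z" and yz: "Sum y z \<equiv>\<^sub>p z"
    using assms by (auto simp: le_trm_def)
  note g = P[THEN guarded_process_term]
  note [trans] = prov_equiv.trans
  have "Sum (Sum x y) z \<equiv>\<^sub>p Sum x (Sum y z)" by (intro prov_equiv.sym[OF prov_equiv.AS] g)
  also have "\<dots> \<equiv>\<^sub>p Sum x z" by (intro Sum_cong prov_equiv.refl g yz)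
  also note xz
  finally show ?thesis using P by (simp add: le_trm_def Sum_process_terms)
qed

text \<open>Describing finite sums as least upper bounds makes their order and multiplicity irrelevant.\<close>

definition is_sum :: "'a trm set \<Rightarrow> 'a trm \<Rightarrow> bool" where
  "is_sum X x \<longleftrightarrow> x \<in> process_terms \<and> (\<forall>y\<in>X. y \<sqsubseteq> x) \<and>
     (\<forall>z\<in>process_terms. (\<forall>y\<in>X. y \<sqsubseteq> z) \<longrightarrow> x \<sqsubseteq> z)"

lemma is_sum_process_terms: "is_sum X x \<Longrightarrow> x \<in> process_terms"
  by (simp add: is_sum_def)

lemma is_sum_unique: "is_sum X x \<Longrightarrow> is_sum X y \<Longrightarrow> x \<equiv>\<^sub>p y"
  unfolding is_sum_def by (blast intro: le_trm_antisym)

lemma is_sum_equiv: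
  assumes "is_sum X x" "x \<equiv>\<^sub>p y" "y \<in> process_terms"
  shows "is_sum X y"
proof -
  have "x \<sqsubseteq> y" "y \<sqsubseteq> x"
    using assms by (auto simp: is_sum_def intro: le_trm_equiv prov_equiv.sym)
  then show ?thesis using assms le_trm_trans unfolding is_sum_def by meson
qed

lemma is_sum_singleton: "x \<in> process_terms \<Longrightarrow> is_sum {x} x"
  by (simp add: is_sum_def le_trm_refl)

lemma is_sum_Un: "is_sum X x \<Longrightarrow> is_sum Y y \<Longrightarrow> is_sum (X \<union> Y) (Sum x y)"
  unfolding is_sum_def Sum_process_terms
  by (meson Un_iff Sum_le_trm le_trm_Sum le_trm_trans)

text \<open>A process term bounds all \<open>X i\<close> exactly when it bounds all
  \<open>g i\<close>. Together with the converse lemma below, this regroups a sum over states as a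
  sum over actions.\<close>

lemma is_sum_UN:
  assumes "is_sum (g ` I) x" "\<And>i. i \<in> I \<Longrightarrow> is_sum (X i) (g i)"
  shows "is_sum (\<Union>i\<in>I. X i) x"
  using assms unfolding is_sum_def by (simp add: ball_UN) (meson le_trm_trans)

lemma is_sum_UN_rev:
  assumes "is_sum (\<Union>i\<in>I. X i) x" "\<And>i. i \<in> I \<Longrightarrow> is_sum (X i) (g i)"
  shows "is_sum (g ` I) x"
  using assms unfolding is_sum_def by (simp add: ball_UN) (meson le_trm_trans)

lemma is_sum_exists: "finite X \<Longrightarrow> X \<noteq> {} \<Longrightarrow> X \<subseteq> process_terms \<Longrightarrow> \<exists>x. is_sum X x"
proof (induction rule: finite_ne_induct)
  case (singleton x) then show ?case using is_sum_singleton by blast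
next
  case (insert x X)
  then obtain y where "is_sum X y" by auto
  then have "is_sum ({x} \<union> X) (Sum x y)"
    using insert.prems by (intro is_sum_Un is_sum_singleton) simp_all
  then show ?case by auto
qed

text \<open>DS splits off one summand per induction step. It is the law that forgets where branching
  happens, and it enters only here.\<close>

lemma is_sum_Pre:
  "finite X \<Longrightarrow> X \<noteq> {} \<Longrightarrow> X \<subseteq> process_terms \<Longrightarrow> is_sum X x \<Longrightarrow> is_sum (Pre a ` X) (Pre a x)"
proof (induction arbitrary: x rule: finite_ne_induct)
  case (singleton y)
  then have "y \<equiv>\<^sub>p x" using is_sum_unique is_sum_singleton by blast
  then have "is_sum {Pre a y} (Pre a x)"
    using singleton is_sum_process_terms
    by (intro is_sum_equiv[OF is_sum_singleton]) (auto simp: Pre_process_terms Pre_cong)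
  then show ?case by simp
next
  case (insert y X)
  then obtain z where z: "is_sum X z" using is_sum_exists by blast
  have P: "y \<in> process_terms" "z \<in> process_terms" "x \<in> process_terms"
    using insert.prems z is_sum_process_terms by auto
  have "is_sum ({y} \<union> X) (Sum y z)" by (intro is_sum_Un is_sum_singleton z P)
  then have "Sum y z \<equiv>\<^sub>p x" using insert.prems is_sum_unique by simp
  then have "Sum (Pre a y) (Pre a z) \<equiv>\<^sub>p Pre a x"
    using P by (meson Pre_cong guarded_process_term prov_equiv.DS prov_equiv.sym prov_equiv.trans)
  moreover have "is_sum ({Pre a y} \<union> Pre a ` X) (Sum (Pre a y) (Pre a z))"
    using insert z P by (intro is_sum_Un is_sum_singleton) (simp_all add: Pre_process_terms)
  ultimately have "is_sum ({Pre a y} \<union> Pre a ` X) (Pre a x)"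
    using P by (simp add: is_sum_equiv Pre_process_terms)
  then show ?case by simp
qed

text \<open>FP unfolds recursions until, by guardedness, only prefixes are exposed; this is the
  fundamental theorem of the calculus.\<close>

lemma is_sum_steps:
  "e \<in> process_terms \<Longrightarrow> is_sum {Pre a f |a f. step e a f} e"
proof (induction rule: process_term_induct)
  case (Pre a e)
  then show ?case by (simp add: step_Pre_iff is_sum_singleton Pre_process_terms)
next
  case (Sum e1 e2)
  have "{Pre a f |a f. step (Sum e1 e2) a f} =
      {Pre a f |a f. step e1 a f} \<union> {Pre a f |a f. step e2 a f}"
    by (auto simp: step_Sum_iff)
  then show ?case using is_sum_Un[OF Sum.IH] by simp
next
  case (Mu v e)
  have "e[Mu v e/v] \<equiv>\<^sub>p Mu v e"
    using Mu.hyps by (intro prov_equiv.sym[OF prov_equiv.FP] guarded_process_term)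
  then show ?case using is_sum_equiv[OF Mu.IH] Mu.hyps by (simp add: step_Mu_iff)
qed


section \<open>Unique solutions of deterministic systems\<close>

text \<open>The value on the empty list is irrelevant: the calculus has no term for the empty sum.\<close>

fun list_sum :: "'a trm list \<Rightarrow> 'a trm" where
  "list_sum [] = Var 0"
| "list_sum [e] = e"
| "list_sum (e # f # es) = Sum e (list_sum (f # es))"

lemma is_sum_list_sum:
  "es \<noteq> [] \<Longrightarrow> set es \<subseteq> process_terms \<Longrightarrow> is_sum (set es) (list_sum es)"
proof (induction es rule: list_sum.induct)
  case (3 e f es)
  then have "is_sum ({e} \<union> set (f # es)) (list_sum (e # f # es))"
    unfolding list_sum.simps by (intro is_sum_Un is_sum_singleton) auto
  then show ?case by (simp add: insert_commute)
qed (auto intro: is_sum_singleton)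

lemma psubst_list_sum: "es \<noteq> [] \<Longrightarrow> psubst s (list_sum es) = list_sum (map (psubst s) es)"
  by (induction es rule: list_sum.induct) auto

lemma guarded_list_sum: "(\<And>e. e \<in> set es \<Longrightarrow> guarded e) \<Longrightarrow> guarded (list_sum es)"
  by (induction es rule: list_sum.induct) auto

lemma unguarded_fv_list_sum:
  "es \<noteq> [] \<Longrightarrow> unguarded_fv (list_sum es) = (\<Union>e\<in>set es. unguarded_fv e)"
  by (induction es rule: list_sum.induct) auto

lemma list_sum_cong:
  "xs \<noteq> [] \<Longrightarrow> (\<And>x. x \<in> set xs \<Longrightarrow> g x \<equiv>\<^sub>p h x) \<Longrightarrow> list_sum (map g xs) \<equiv>\<^sub>p list_sum (map h xs)"
  by (induction xs rule: induct_list012) (auto intro: Sum_cong)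

text \<open>\<open>acts q\<close> is a list because a term fixes an order of its summands;
  \<open>c\<close> assigns to distinct states distinct variables, which serve as their
  binders.\<close>

locale deterministic_system =
  fixes Q :: "'q set" and acts :: "'q \<Rightarrow> 'a list" and \<delta> :: "'q \<Rightarrow> 'a \<Rightarrow> 'q" and c :: "'q \<Rightarrow> nat"
  assumes finite_Q: "finite Q"
    and acts_nonempty: "q \<in> Q \<Longrightarrow> acts q \<noteq> []"
    and \<delta>_closed: "q \<in> Q \<Longrightarrow> a \<in> set (acts q) \<Longrightarrow> \<delta> q a \<in> Q"
    and inj_c: "inj_on c Q"
begin

text \<open>In \<open>solution n V q\<close>, the set \<open>V\<close> contains the states whose variables are bound by an enclosing
  \<open>Mu\<close>; the fuel \<open>n\<close> suffices if it is at least the number of the other states.\<close>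

fun solution :: "nat \<Rightarrow> 'q set \<Rightarrow> 'q \<Rightarrow> 'a trm" where
  "solution 0 V q = Var (c q)"
| "solution (Suc n) V q =
    (if q \<in> V then Var (c q)
     else Mu (c q) (list_sum (map (\<lambda>a. Pre a (solution n (insert q V) (\<delta> q a))) (acts q))))"

text \<open>Each recursive call sits under a prefix, so no variable is unguarded in the body of a
  \<open>Mu\<close>.\<close>

lemma guarded_solution: "q \<in> Q \<Longrightarrow> guarded (solution n V q)"
proof (induction n arbitrary: V q)
  case (Suc n)
  then show ?case
    using acts_nonempty \<delta>_closed
    by (auto intro!: guarded_list_sum simp: unguarded_fv_list_sum)
qed simp

text \<open>The claim is strengthened to partially unravelled terms: the variable of a visited state
  is read as the value of \<open>G\<close> there, and \<open>inv_into Q c\<close> recovers the state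
  from the variable.\<close>

lemma solution_unique_aux:
  assumes P: "\<And>q. q \<in> Q \<Longrightarrow> G q \<in> process_terms"
    and G: "\<And>q. q \<in> Q \<Longrightarrow> is_sum ((\<lambda>a. Pre a (G (\<delta> q a))) ` set (acts q)) (G q)"
    and "q \<in> Q" "V \<subseteq> Q" "card (Q - V) \<le> n"
  shows "G q \<equiv>\<^sub>p psubst (\<lambda>v. if v \<in> c ` V then G (inv_into Q c v) else Var v) (solution n V q)"
  using assms(3-)
proof (induction n arbitrary: V q)
  case 0
  \<comment> \<open>With no fuel left, every state of \<open>Q\<close> has been visited.\<close>
  then have "q \<in> V" using finite_Q by auto
  then show ?case using 0 P inj_c by (simp add: prov_equiv.refl guarded_process_term)
next
  case (Suc n)
  let ?s = "\<lambda>V v. if v \<in> c ` V then G (inv_into Q c v) else Var v"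
  show ?case
  proof (cases "q \<in> V")
    case True
    then show ?thesis using Suc.prems P inj_c by (simp add: prov_equiv.refl guarded_process_term)
  next
    case False
    let ?t = "\<lambda>a. solution n (insert q V) (\<delta> q a)"
    let ?E = "list_sum (map (\<lambda>a. Pre a (?t a)) (acts q))"
    have closing: "closing (?s V) X" for X
      using P Suc.prems(2) inj_c by (auto simp: closing_def)
    \<comment> \<open>Putting \<open>G q\<close> for the bound variable turns the substitution for
      \<open>V\<close> into the one for \<open>insert q V\<close>, where the induction hypothesis
      lives.\<close>
    have s_upd: "(?s V)(c q := G q) = ?s (insert q V)"
      using Suc.prems(1) inj_c by auto
    have nonempty: "acts q \<noteq> []" using acts_nonempty Suc.prems(1) .
    have E: "psubst r ?E = list_sum (map (\<lambda>a. Pre a (psubst r (?t a))) (acts q))" for r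
      using nonempty by (simp add: psubst_list_sum o_def)
    have eq: "psubst (?s V) (solution (Suc n) V q) = Mu (c q) (psubst ((?s V)(c q := Var (c q))) ?E)"
      using False psubst_Mu[OF closing] by (simp only: solution.simps if_False)
    have "card (Q - insert q V) < card (Q - V)"
      using Suc.prems False finite_Q by (intro psubset_card_mono) auto
    then have IH: "G (\<delta> q a) \<equiv>\<^sub>p psubst (?s (insert q V)) (?t a)" if "a \<in> set (acts q)" for a
      using Suc \<delta>_closed[OF Suc.prems(1) that] by (intro Suc.IH) auto
    note [trans] = prov_equiv.trans
    have "is_sum (set (map (\<lambda>a. Pre a (G (\<delta> q a))) (acts q))) (list_sum (map (\<lambda>a. Pre a (G (\<delta> q a))) (acts q)))"
      by (rule is_sum_list_sum) (use nonempty Suc.prems(1) \<delta>_closed P in \<open>auto simp: Pre_process_terms\<close>)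
    then have "G q \<equiv>\<^sub>p list_sum (map (\<lambda>a. Pre a (G (\<delta> q a))) (acts q))"
      using G[OF Suc.prems(1)] by (auto intro: is_sum_unique)
    also have "\<dots> \<equiv>\<^sub>p list_sum (map (\<lambda>a. Pre a (psubst (?s (insert q V)) (?t a))) (acts q))"
      by (intro list_sum_cong nonempty Pre_cong IH)
    \<comment> \<open>The two stages, closing the body and then inserting \<open>G q\<close>, are
      separated again to match the premise of UA.\<close>
    also have "\<dots> = (psubst ((?s V)(c q := Var (c q))) ?E)[G q/c q]"
      unfolding subst_psubst_upd[OF closing P[OF Suc.prems(1)]] s_upd by (rule E[symmetric])
    finally have "G q \<equiv>\<^sub>p (psubst ((?s V)(c q := Var (c q))) ?E)[G q/c q]" .
    moreover have "guarded (Mu (c q) (psubst ((?s V)(c q := Var (c q))) ?E))"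
    proof -
      have "guarded (psubst ((?s V)(c q := Var (c q))) ?E)"
        using Suc.prems(1) \<delta>_closed
        by (intro guarded_psubst closing_upd_Var closing guarded_list_sum) (auto simp: guarded_solution)
      moreover have "unguarded_fv (psubst ((?s V)(c q := Var (c q))) ?E) = {}"
        unfolding E using nonempty by (simp add: unguarded_fv_list_sum)
      ultimately show ?thesis by simp
    qed
    ultimately show ?thesis unfolding eq by (rule prov_equiv.UA[rotated])
  qed
qed

text \<open>With no state visited the substitution is the identity, so both families equal one term
  that depends only on the system.\<close>

lemma solution_unique:
  assumes "\<And>q. q \<in> Q \<Longrightarrow> G q \<in> process_terms" "\<And>q. q \<in> Q \<Longrightarrow> H q \<in> process_terms"
    and "\<And>q. q \<in> Q \<Longrightarrow> is_sum ((\<lambda>a. Pre a (G (\<delta> q a))) ` set (acts q)) (G q)"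
    and "\<And>q. q \<in> Q \<Longrightarrow> is_sum ((\<lambda>a. Pre a (H (\<delta> q a))) ` set (acts q)) (H q)"
    and "q \<in> Q"
  shows "G q \<equiv>\<^sub>p H q"
proof -
  have "G q \<equiv>\<^sub>p solution (card Q) {} q" "H q \<equiv>\<^sub>p solution (card Q) {} q"
    using solution_unique_aux[of G q "{}" "card Q"] solution_unique_aux[of H q "{}" "card Q"] assms
    by (simp_all add: psubst_Var)
  then show ?thesis using prov_equiv.sym prov_equiv.trans by blast
qed

end


section \<open>Determinization\<close>

definition sum_of :: "'a trm set \<Rightarrow> 'a trm" where
  "sum_of S = (SOME x. is_sum S x)"

lemma is_sum_sum_of: "finite S \<Longrightarrow> S \<noteq> {} \<Longrightarrow> S \<subseteq> process_terms \<Longrightarrow> is_sum S (sum_of S)"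
  unfolding sum_of_def using is_sum_exists by (rule someI_ex)

definition post :: "'a trm set \<Rightarrow> 'a \<Rightarrow> 'a trm set" where
  "post S a = {f. \<exists>e\<in>S. step e a f}"

text \<open>\<open>is_sum_steps\<close> expands each member of \<open>S\<close>; collecting the
  summands by action and merging each group under its prefix with \<open>is_sum_Pre\<close> gives
  the subset construction.\<close>

lemma is_sum_post:
  assumes R: "finite R" "R \<subseteq> process_terms" "\<And>g a f. g \<in> R \<Longrightarrow> step g a f \<Longrightarrow> f \<in> R"
    and S: "S \<subseteq> R" "S \<noteq> {}"
  shows "is_sum ((\<lambda>a. Pre a (sum_of (post S a))) ` {a. post S a \<noteq> {}}) (sum_of S)"
proof (rule is_sum_UN_rev)
  have post: "post S a \<subseteq> R" for a using R(3) S(1) by (auto simp: post_def)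
  have SP: "S \<subseteq> process_terms" using S R by blast
  have "is_sum (id ` S) (sum_of S)"
    using is_sum_sum_of[of S] finite_subset[OF S(1) R(1)] S(2) SP by simp
  then have "is_sum (\<Union>e\<in>S. {Pre a f |a f. step e a f}) (sum_of S)"
    by (rule is_sum_UN) (use SP is_sum_steps in auto)
  moreover have "(\<Union>e\<in>S. {Pre a f |a f. step e a f}) = (\<Union>a\<in>{a. post S a \<noteq> {}}. Pre a ` post S a)"
    by (auto simp: post_def)
  ultimately show "is_sum (\<Union>a\<in>{a. post S a \<noteq> {}}. Pre a ` post S a) (sum_of S)" by simp
  fix a assume "a \<in> {a. post S a \<noteq> {}}"
  then show "is_sum (Pre a ` post S a) (Pre a (sum_of (post S a)))"
    using finite_subset[OF post R(1)] order_trans[OF post R(2)]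
    by (intro is_sum_Pre is_sum_sum_of) auto
qed

text \<open>Successor sets correspond to Brzozowski derivatives of the trace language, so trace
  equality of two sets passes to their successors.\<close>

lemma traces_post: "(\<Union>f\<in>post S a. traces f) = {w. a # w \<in> (\<Union>e\<in>S. traces e)}"
  by (auto simp: post_def Cons_in_traces)

text \<open>The enabled actions depend on the traces alone, so trace-equal sets share one list of
  actions.\<close>

lemma post_nonempty_iff: "post S a \<noteq> {} \<longleftrightarrow> [a] \<in> (\<Union>e\<in>S. traces e)"
  by (auto simp: post_def Cons_in_traces Nil_in_traces)

lemma traces_complete:
  fixes e f :: "'a::finite trm"
  assumes e: "e \<in> process_terms" and f: "f \<in> process_terms" and eq: "traces e = traces f"
  shows "e \<equiv>\<^sub>p f"
proof -
  obtain Re where Re: "finite Re" "e \<in> Re" "Re \<subseteq> process_terms"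
    "\<And>g a f. g \<in> Re \<Longrightarrow> step g a f \<Longrightarrow> f \<in> Re"
    using finite_reachable[OF e] by blast
  obtain Rf where Rf: "finite Rf" "f \<in> Rf" "Rf \<subseteq> process_terms"
    "\<And>g a h. g \<in> Rf \<Longrightarrow> step g a h \<Longrightarrow> h \<in> Rf"
    using finite_reachable[OF f] by blast
  \<comment> \<open>Pairing the state sets lets both determinizations run over one common system,
    which its two projections solve.\<close>
  define Q where "Q = {(S, T). S \<subseteq> Re \<and> T \<subseteq> Rf \<and> S \<noteq> {} \<and> T \<noteq> {} \<and>
    (\<Union>e\<in>S. traces e) = (\<Union>e\<in>T. traces e)}"
  \<comment> \<open>Any enumeration serves, and one exists because there are finitely many actions;
    it is read off the first component, and \<open>acts'\<close> shows that the second
    agrees.\<close>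
  define acts :: "'a trm set \<times> 'a trm set \<Rightarrow> 'a list"
    where "acts q = (SOME as. set as = {a. post (fst q) a \<noteq> {}})" for q
  define \<delta> where "\<delta> q a = (post (fst q) a, post (snd q) a)"
    for q :: "'a trm set \<times> 'a trm set" and a
  have acts: "set (acts q) = {a. post (fst q) a \<noteq> {}}" for q
    unfolding acts_def by (rule someI_ex) (rule finite_list, simp)
  have traces_Q: "(\<Union>e\<in>fst q. traces e) = (\<Union>e\<in>snd q. traces e)" if "q \<in> Q" for q
    using that by (simp add: Q_def case_prod_beta)
  have acts': "set (acts q) = {a. post (snd q) a \<noteq> {}}" if "q \<in> Q" for q
    by (simp only: acts post_nonempty_iff traces_Q[OF that])
  have "finite Q"
    by (rule finite_subset[of _ "Pow Re \<times> Pow Rf"]) (use Re(1) Rf(1) in \<open>auto simp: Q_def\<close>)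
  then obtain c :: "_ \<Rightarrow> nat" where c: "inj_on c Q"
    using finite_imp_inj_to_nat_seg by blast
  interpret deterministic_system Q acts \<delta> c
  proof
    fix q assume q: "q \<in> Q"
    then obtain g where g: "g \<in> fst q" "g \<in> process_terms" using Re(3) by (fastforce simp: Q_def)
    obtain a h where "step g a h" using step_total[OF g(2)] by blast
    then have "a \<in> set (acts q)" using g(1) by (auto simp: acts post_def)
    then show "acts q \<noteq> []" by auto
    fix a assume a: "a \<in> set (acts q)"
    have "(\<Union>e\<in>post (fst q) a. traces e) = (\<Union>e\<in>post (snd q) a. traces e)"
      by (simp only: traces_post traces_Q[OF q])
    moreover have "post (fst q) a \<noteq> {}" "post (snd q) a \<noteq> {}"
      using a acts acts'[OF q] by auto
    moreover have "post (fst q) a \<subseteq> Re" "post (snd q) a \<subseteq> Rf"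
      using q Re(4) Rf(4) by (fastforce simp: Q_def post_def)+
    ultimately show "\<delta> q a \<in> Q" by (simp add: Q_def \<delta>_def)
  qed fact+
  have S: "fst q \<subseteq> Re" "fst q \<noteq> {}" "snd q \<subseteq> Rf" "snd q \<noteq> {}" if "q \<in> Q" for q
    using that by (auto simp: Q_def)
  have sums: "is_sum ((\<lambda>a. Pre a (sum_of (fst (\<delta> q a)))) ` set (acts q)) (sum_of (fst q))"
    "is_sum ((\<lambda>a. Pre a (sum_of (snd (\<delta> q a)))) ` set (acts q)) (sum_of (snd q))" if q: "q \<in> Q" for q
  proof -
    show "is_sum ((\<lambda>a. Pre a (sum_of (fst (\<delta> q a)))) ` set (acts q)) (sum_of (fst q))"
      using is_sum_post[OF Re(1,3,4) S(1,2)[OF q]] by (simp add: acts \<delta>_def)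
    show "is_sum ((\<lambda>a. Pre a (sum_of (snd (\<delta> q a)))) ` set (acts q)) (sum_of (snd q))"
      using is_sum_post[OF Rf(1,3,4) S(3,4)[OF q]] by (simp add: acts'[OF q] \<delta>_def)
  qed
  \<comment> \<open>At the pair of singletons the two solutions are \<open>e\<close> and
    \<open>f\<close> up to provable equivalence.\<close>
  have "({e}, {f}) \<in> Q" using Re(2) Rf(2) eq by (simp add: Q_def)
  then have "sum_of (fst ({e}, {f})) \<equiv>\<^sub>p sum_of (snd ({e}, {f}))"
    using sums is_sum_process_terms by (intro solution_unique[of "\<lambda>q. sum_of (fst q)" "\<lambda>q. sum_of (snd q)"]) blast+
  then have mid: "sum_of {e} \<equiv>\<^sub>p sum_of {f}" by simp
  have "e \<equiv>\<^sub>p sum_of {e}" "f \<equiv>\<^sub>p sum_of {f}"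
    using e f by (auto intro: is_sum_unique is_sum_singleton is_sum_sum_of)
  then show ?thesis using mid prov_equiv.sym prov_equiv.trans by blast
qed


section \<open>Completeness\<close>

theorem mainTheorem8:
  fixes e f :: "'a::finite trm"
  assumes "e \<in> process_terms" and "f \<in> process_terms"
    and "e \<approx>\<^sub>f f"
  shows "e \<equiv>\<^sub>p f"
  using fractal_equiv_imp_str_eq[OF assms(3)] traces_eq_prefixes[OF assms(1)]
    traces_eq_prefixes[OF assms(2)] traces_complete[OF assms(1,2)] by simp

end
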